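(* Let $P_j = (x_j,y_j)$, $j \in \{0,1,2\}$, be finite points of $EC$ (coordinates regarded as integers in $\{0,\ldots,\wp-1\}$), and for a polynomial term $\sigma$ over $\mathcal{V} = (Y_0\ Y_1\ Y_2\ X_0\ X_1\ X_2)$ let $\hat{\sigma} \in \mathbb{Z}$ be its value under the assignment $Y_j \mapsto y_j$, $X_j \mapsto x_j$. For all polynomial terms $\sigma,\tau \in \mathcal{T}(\mathcal{V})$, if $\mathit{reduce}(\sigma) = \mathit{reduce}(\tau)$, then $\hat{\sigma} \equiv \hat{\tau} \pmod{\wp}$.
   Context: Let $\wp = 2^{255}-19$ (a prime), $A = 486662$, $\mathbb{F}_\wp = \{0,\ldots,\wp-1\}$ the field of order $\wp$, and $EC = \{(x,y) \in \mathbb{F}_\wp \times \mathbb{F}_\wp \mid y^2 = x^3 + Ax^2 + x\} \cup \{\infty\}$; finite points are those other than $\infty$. Polynomial terms: $\mathcal{T}(V)$ is the set of formal expressions built from integers and symbols of a list $V=(v_0\ldots v_{k-1})$ using $(+\ y\ z)$, $(-\ y\ z)$, $(-\ y)$, $( *\ y\ z)$ and $(\mathrm{EXPT}\ y\ k)$ with $k \in \mathbb{N}$, evaluated in the natural way. Sparse Horner forms (SHF): an SHF is an integer, or $(\mathrm{POP}\ i\ p)$ with $i \in \mathbb{N}$ and $p$ an SHF, or $(\mathrm{POW}\ i\ p\ q)$ with $i \in \mathbb{N}$ and $p,q$ SHFs. An SHF is normal if its components are normal and it is neither $(\mathrm{POP}\ i\ p)$ with $i=0$ or $p \in \mathbb{Z}$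 or $p = (\mathrm{POP}\ j\ q)$, nor $(\mathrm{POW}\ i\ p\ q)$ with $i=0$ or $p = (\mathrm{POW}\ j\ r\ 0)$. $\mathcal{H}$ is the set of normal SHFs. Basic functions: $\mathit{pop}(i,p)$ is $p$ if $i=0$ or $p \in \mathbb{Z}$; $(\mathrm{POP}\ i+j\ q)$ if $p=(\mathrm{POP}\ j\ q)$; and $(\mathrm{POP}\ i\ p)$ otherwise. For $i \geq 1$, $\mathit{pow}(i,p,q)$ is $\mathit{pop}(1,q)$ if $p=0$; $(\mathrm{POW}\ i+j\ r\ q)$ if $p=(\mathrm{POW}\ j\ r\ 0)$; and $(\mathrm{POW}\ i\ p\ q)$ otherwise. Operations $\oplus$, $\otimes$ on $x,y \in \mathcal{H}$, defined recursively: (1) $x \in \mathbb{Z}$: if $y\in\mathbb{Z}$, $x\oplus y = x+y$, $x \otimes y = xy$; if $y=(\mathrm{POP}\ i\ p)$, $x\oplus y=(\mathrm{POP}\ i\ x\oplus p)$, $x\otimes y=\mathit{pop}(i,x\otimes p)$; if $y=(\mathrm{POW}\ i\ p\ q)$, $x\oplus y=(\mathrm{POW}\ i\ p\ x\oplus q)$, $x\otimes y=\mathit{pow}(i,x\otimes p,x\otimes q)$. (2) $y\in\mathbb{Z}$: $x\oplus y=y\oplus x$, $x\otimes y=y\otimes x$. (3) $x=(\mathrm{POP}\ i\ p)$, $y=(\mathrm{POP}\ j\ q)$, with $\circ$ denoting $\oplus$ or $\otimes$: $x\circ y=\mathit{pop}(i,p\circ q)$ if $i=j$; $\mathit{pop}(j,(\mathrm{POP}\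 i-j\ p)\circ q)$ if $i>j$; $\mathit{pop}(i,(\mathrm{POP}\ j-i\ q)\circ p)$ if $i<j$. (4) $x=(\mathrm{POP}\ i\ p)$, $y=(\mathrm{POW}\ j\ q\ r)$: if $i=1$, $x\oplus y=(\mathrm{POW}\ j\ q\ r\oplus p)$, $x\otimes y=(\mathrm{POW}\ j\ x\otimes q\ p\otimes r)$; if $i>1$, $x\oplus y=(\mathrm{POW}\ j\ q\ r\oplus(\mathrm{POP}\ i-1\ p))$, $x\otimes y=(\mathrm{POW}\ j\ x\otimes q\ (\mathrm{POP}\ i-1\ p)\otimes r)$. (5) $x=(\mathrm{POW}\ j\ q\ r)$, $y=(\mathrm{POP}\ i\ p)$: $x\oplus y=y\oplus x$, $x\otimes y=y\otimes x$. (6) $x=(\mathrm{POW}\ i\ p\ q)$, $y=(\mathrm{POW}\ j\ r\ s)$: $x\oplus y=\mathit{pow}(i,p\oplus r,q\oplus s)$ if $i=j$; $\mathit{pow}(j,(\mathrm{POW}\ i-j\ p\ 0)\oplus r,q\oplus s)$ if $i>j$; $\mathit{pow}(i,(\mathrm{POW}\ j-i\ r\ 0)\oplus p,s\oplus q)$ if $i<j$; and $x\otimes y=(\mathit{pow}(i+j,p\otimes r,q\otimes s)\oplus\mathit{pow}(i,p\otimes\mathit{pop}(1,s),0))\oplus\mathit{pow}(j,r\otimes\mathit{pop}(1,q),0)$. Negation: $\ominus x=-x$ for $x\in\mathbb{Z}$, $\ominus(\mathrm{POP}\ i\ p)=(\mathrm{POP}\ i\ \ominus p)$, $\ominus(\mathrm{POW}\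 i\ p\ q)=(\mathrm{POW}\ i\ \ominus p\ \ominus q)$. Powers: $x^0=1$, $x^k=x\otimes x^{k-1}$ for $k>0$. Normalization: $\mathit{norm}(x,V)=x$ for $x\in\mathbb{Z}$; $\mathit{norm}(v_i,V)=\mathit{pop}(i,(\mathrm{POW}\ 1\ 1\ 0))$; $\mathit{norm}((-\ y),V)=\ominus\mathit{norm}(y,V)$; $\mathit{norm}((+\ y\ z),V)=\mathit{norm}(y,V)\oplus\mathit{norm}(z,V)$; $\mathit{norm}((-\ y\ z),V)=\mathit{norm}(y,V)\oplus(\ominus\mathit{norm}(z,V))$; $\mathit{norm}(( *\ y\ z),V)=\mathit{norm}(y,V)\otimes\mathit{norm}(z,V)$; $\mathit{norm}((\mathrm{EXPT}\ y\ k),V)=\mathit{norm}(y,V)^k$. Reduction: let $\Theta = (\mathrm{POP}\ 3\ (\mathrm{POW}\ 1\ (\mathrm{POW}\ 1\ (\mathrm{POW}\ 1\ 1\ A)\ 1)\ 0))$. For $h\in\mathcal{H}$, $j\in\{0,1,2\}$, $k\in\mathbb{N}$, the pair $\mathit{split}(h,j,k)$ is defined recursively: (i) if $h\in\mathbb{Z}$ or $j<k$, it is $(h,0)$; (ii) if $j\geq k$, $h=(\mathrm{POP}\ i\ p)$ and $(p_0,p_1)=\mathit{split}(p,j,k+i)$, it is $(\mathit{pop}(i,p_0),\mathit{pop}(i,p_1))$; (iii) if $j\geq k$, $h=(\mathrm{POW}\ i\ p\ q)$, $(p_0,p_1)=\mathit{split}(p,j,k)$ and $(q_0,q_1)=\mathit{split}(q,j,k+1)$,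 it is $(\mathit{pow}(i,p_0,q_0),\mathit{pow}(i,p_1,q_1))$ when $j>k$; $((\Theta^{i/2}\otimes p_0)\oplus\mathit{pop}(1,q_0),\ (\Theta^{i/2}\otimes p_1)\oplus\mathit{pop}(1,q_1))$ when $j=k$ and $i$ is even; and $((\Theta^{(i+1)/2}\otimes p_1)\oplus\mathit{pop}(1,q_0),\ (\Theta^{(i-1)/2}\otimes p_0)\oplus\mathit{pop}(1,q_1))$ when $j=k$ and $i$ is odd. With $(h_0,h_1)=\mathit{split}(h,j,0)$, put $\mathit{rewrite}(h,j)=h_0\oplus(h_1\otimes\mathit{norm}(Y_j,\mathcal{V}))$. Finally $\mathit{reduce}(\sigma)=\mathit{rewrite}(\mathit{rewrite}(\mathit{rewrite}(\mathit{norm}(\sigma,\mathcal{V}),0),1),2)$. *)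

theory Defs
  imports Main "HOL-Number_Theory.Cong"
begin

definition wp :: int where
  "wp = 2 ^ 255 - 19"

definition coeffA :: int where
  "coeffA = 486662"

text \<open>The field of order \<open>wp\<close> is represented by its least residues, so its equations are
  congruences modulo \<open>wp\<close>.\<close>

definition Fwp :: "int set" where
  "Fwp = {0..<wp}"

datatype point = Infinity | Finite int int

definition EC :: "point set" where
  "EC = {Finite x y | x y. x \<in> Fwp \<and> y \<in> Fwp \<and> [y ^ 2 = x ^ 3 + coeffA * x ^ 2 + x] (mod wp)}
        \<union> {Infinity}"

datatype 'v pterm =
    TInt int
  | TVar 'v
  | TAdd "'v pterm" "'v pterm"
  | TSub "'v pterm" "'v pterm"
  | TNeg "'v pterm"
  | TMul "'v pterm" "'v pterm"
  | TExpt "'v pterm" nat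

definition pterms :: "'v list \<Rightarrow> 'v pterm set" where
  "pterms V = {\<sigma>. set_pterm \<sigma> \<subseteq> set V}"

fun term_val :: "('v \<Rightarrow> int) \<Rightarrow> 'v pterm \<Rightarrow> int" where
  "term_val a (TInt n) = n"
| "term_val a (TVar v) = a v"
| "term_val a (TAdd y z) = term_val a y + term_val a z"
| "term_val a (TSub y z) = term_val a y - term_val a z"
| "term_val a (TNeg y) = - term_val a y"
| "term_val a (TMul y z) = term_val a y * term_val a z"
| "term_val a (TExpt y k) = term_val a y ^ k"

datatype shf = Const int | POP nat shf | POW nat shf shf

fun normal_shf :: "shf \<Rightarrow> bool" where
  "normal_shf (Const n) \<longleftrightarrow> True"
| "normal_shf (POP i p) \<longleftrightarrow> normal_shf p \<and>
     \<not> (i = 0 \<or> (\<exists>n. p = Const n) \<or> (\<exists>j q. p = POP j q))"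
| "normal_shf (POW i p q) \<longleftrightarrow> normal_shf p \<and> normal_shf q \<and>
     \<not> (i = 0 \<or> (\<exists>j r. p = POW j r (Const 0)))"

text \<open>In the source the functions below have the normal forms as their domain. Here they are
  total: the defining equations are used verbatim on all of \<^typ>\<open>shf\<close>. The only missing case,
  combining \<open>POP 0 p\<close> with a \<open>POW\<close> (excluded by normality), is supplied by reading
  \<open>POP 0 p\<close> as \<open>p\<close>, in accordance with \<open>shf_pop 0 p = p\<close>.\<close>

fun shf_pop :: "nat \<Rightarrow> shf \<Rightarrow> shf" where
  "shf_pop i (Const n) = Const n"
| "shf_pop i (POP j q) = (if i = 0 then POP j q else POP (i + j) q)"
| "shf_pop i (POW j p q) = (if i = 0 then POW j p q else POP i (POW j p q))"

definition shf_pow :: "nat \<Rightarrow> shf \<Rightarrow> shf \<Rightarrow> shf" where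
  "shf_pow i p q =
    (if p = Const 0 then shf_pop 1 q
     else case p of
       POW j r s \<Rightarrow> if s = Const 0 then POW (i + j) r q else POW i p q
     | _ \<Rightarrow> POW i p q)"

text \<open>Termination measure: the sum of the sizes, where the cases that only swap the arguments
  weigh one more than the swapped ones.\<close>

fun shf_rank :: "shf \<Rightarrow> nat" where
  "shf_rank (Const n) = 0"
| "shf_rank (POP i p) = 1"
| "shf_rank (POW i p q) = 2"

definition shf_measure :: "shf \<times> shf \<Rightarrow> nat" where
  "shf_measure = (\<lambda>(x, y). 2 * (size x + size y) + (if shf_rank y < shf_rank x then 1 else 0))"

lemma size_shf_pop_le: "size (shf_pop i p) \<le> Suc (size p)"
  by (cases p) auto

function (sequential) shf_add :: "shf \<Rightarrow> shf \<Rightarrow> shf"  (infixl "\<oplus>\<^sub>H" 65) where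
  "Const m \<oplus>\<^sub>H Const n = Const (m + n)"
| "Const m \<oplus>\<^sub>H POP i p = POP i (Const m \<oplus>\<^sub>H p)"
| "Const m \<oplus>\<^sub>H POW i p q = POW i p (Const m \<oplus>\<^sub>H q)"
| "POP i p \<oplus>\<^sub>H Const n = Const n \<oplus>\<^sub>H POP i p"
| "POW i p q \<oplus>\<^sub>H Const n = Const n \<oplus>\<^sub>H POW i p q"
| "POP i p \<oplus>\<^sub>H POP j q =
     (if i = j then shf_pop i (p \<oplus>\<^sub>H q)
      else if i > j then shf_pop j (POP (i - j) p \<oplus>\<^sub>H q)
      else shf_pop i (POP (j - i) q \<oplus>\<^sub>H p))"
| "POP i p \<oplus>\<^sub>H POW j q r =
     (if i = 0 then p \<oplus>\<^sub>H POW j q r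
      else if i = 1 then POW j q (r \<oplus>\<^sub>H p)
      else POW j q (r \<oplus>\<^sub>H POP (i - 1) p))"
| "POW j q r \<oplus>\<^sub>H POP i p = POP i p \<oplus>\<^sub>H POW j q r"
| "POW i p q \<oplus>\<^sub>H POW j r s =
     (if i = j then shf_pow i (p \<oplus>\<^sub>H r) (q \<oplus>\<^sub>H s)
      else if i > j then shf_pow j (POW (i - j) p (Const 0) \<oplus>\<^sub>H r) (q \<oplus>\<^sub>H s)
      else shf_pow i (POW (j - i) r (Const 0) \<oplus>\<^sub>H p) (s \<oplus>\<^sub>H q))"
  by pat_completeness auto
termination
  by (relation "measure shf_measure") (auto simp: shf_measure_def)

function (sequential) shf_mult :: "shf \<Rightarrow> shf \<Rightarrow> shf"  (infixl "\<otimes>\<^sub>H" 70) where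
  "Const m \<otimes>\<^sub>H Const n = Const (m * n)"
| "Const m \<otimes>\<^sub>H POP i p = shf_pop i (Const m \<otimes>\<^sub>H p)"
| "Const m \<otimes>\<^sub>H POW i p q = shf_pow i (Const m \<otimes>\<^sub>H p) (Const m \<otimes>\<^sub>H q)"
| "POP i p \<otimes>\<^sub>H Const n = Const n \<otimes>\<^sub>H POP i p"
| "POW i p q \<otimes>\<^sub>H Const n = Const n \<otimes>\<^sub>H POW i p q"
| "POP i p \<otimes>\<^sub>H POP j q =
     (if i = j then shf_pop i (p \<otimes>\<^sub>H q)
      else if i > j then shf_pop j (POP (i - j) p \<otimes>\<^sub>H q)
      else shf_pop i (POP (j - i) q \<otimes>\<^sub>H p))"
| "POP i p \<otimes>\<^sub>H POW j q r =
     (if i = 0 then p \<otimes>\<^sub>H POW j q r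
      else if i = 1 then POW j (POP i p \<otimes>\<^sub>H q) (p \<otimes>\<^sub>H r)
      else POW j (POP i p \<otimes>\<^sub>H q) (POP (i - 1) p \<otimes>\<^sub>H r))"
| "POW j q r \<otimes>\<^sub>H POP i p = POP i p \<otimes>\<^sub>H POW j q r"
| "POW i p q \<otimes>\<^sub>H POW j r s =
     (shf_pow (i + j) (p \<otimes>\<^sub>H r) (q \<otimes>\<^sub>H s)
      \<oplus>\<^sub>H shf_pow i (p \<otimes>\<^sub>H shf_pop 1 s) (Const 0))
      \<oplus>\<^sub>H shf_pow j (r \<otimes>\<^sub>H shf_pop 1 q) (Const 0)"
  by pat_completeness auto
termination
proof (relation "measure shf_measure")
  fix i j :: nat and p q r s :: shf
  show "((p, shf_pop 1 s), (POW i p q, POW j r s)) \<in> measure shf_measure"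
    using size_shf_pop_le[of 1 s] by (auto simp: shf_measure_def)
  show "((r, shf_pop 1 q), (POW i p q, POW j r s)) \<in> measure shf_measure"
    using size_shf_pop_le[of 1 q] by (auto simp: shf_measure_def)
qed (auto simp: shf_measure_def)

fun shf_neg :: "shf \<Rightarrow> shf"  ("\<ominus>\<^sub>H _" [81] 80) where
  "\<ominus>\<^sub>H Const n = Const (- n)"
| "\<ominus>\<^sub>H POP i p = POP i (\<ominus>\<^sub>H p)"
| "\<ominus>\<^sub>H POW i p q = POW i (\<ominus>\<^sub>H p) (\<ominus>\<^sub>H q)"

fun shf_power :: "shf \<Rightarrow> nat \<Rightarrow> shf" where
  "shf_power x 0 = Const 1"
| "shf_power x (Suc k) = x \<otimes>\<^sub>H shf_power x k"

definition var_index :: "'v list \<Rightarrow> 'v \<Rightarrow> nat" where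
  "var_index V v = length (takeWhile (\<lambda>u. u \<noteq> v) V)"

fun shf_norm :: "'v list \<Rightarrow> 'v pterm \<Rightarrow> shf" where
  "shf_norm V (TInt n) = Const n"
| "shf_norm V (TVar v) = shf_pop (var_index V v) (POW 1 (Const 1) (Const 0))"
| "shf_norm V (TNeg y) = \<ominus>\<^sub>H shf_norm V y"
| "shf_norm V (TAdd y z) = shf_norm V y \<oplus>\<^sub>H shf_norm V z"
| "shf_norm V (TSub y z) = shf_norm V y \<oplus>\<^sub>H (\<ominus>\<^sub>H shf_norm V z)"
| "shf_norm V (TMul y z) = shf_norm V y \<otimes>\<^sub>H shf_norm V z"
| "shf_norm V (TExpt y k) = shf_power (shf_norm V y) k"

datatype var = X nat | Y nat

definition vars :: "var list" where
  "vars = [Y 0, Y 1, Y 2, X 0, X 1, X 2]"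

text \<open>Relative to the variable list that starts with \<open>Y j\<close>, the variable \<open>X j\<close> has index 3, so
  that \<open>Theta\<close> represents the right-hand side of the curve equation at \<open>X j\<close>.\<close>

definition Theta :: shf where
  "Theta = POP 3 (POW 1 (POW 1 (POW 1 (Const 1) (Const coeffA)) (Const 1)) (Const 0))"

fun shf_split :: "shf \<Rightarrow> nat \<Rightarrow> nat \<Rightarrow> shf \<times> shf" where
  "shf_split (Const n) j k = (Const n, Const 0)"
| "shf_split (POP i p) j k =
     (if j < k then (POP i p, Const 0)
      else let (p0, p1) = shf_split p j (k + i)
           in (shf_pop i p0, shf_pop i p1))"
| "shf_split (POW i p q) j k =
     (if j < k then (POW i p q, Const 0)
      else let (p0, p1) = shf_split p j k; (q0, q1) = shf_split q j (k + 1)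
           in if j > k then (shf_pow i p0 q0, shf_pow i p1 q1)
              else if even i then
                ((shf_power Theta (i div 2) \<otimes>\<^sub>H p0) \<oplus>\<^sub>H shf_pop 1 q0,
                 (shf_power Theta (i div 2) \<otimes>\<^sub>H p1) \<oplus>\<^sub>H shf_pop 1 q1)
              else
                ((shf_power Theta ((i + 1) div 2) \<otimes>\<^sub>H p1) \<oplus>\<^sub>H shf_pop 1 q0,
                 (shf_power Theta ((i - 1) div 2) \<otimes>\<^sub>H p0) \<oplus>\<^sub>H shf_pop 1 q1))"

definition shf_rewrite :: "shf \<Rightarrow> nat \<Rightarrow> shf" where
  "shf_rewrite h j =
    (let (h0, h1) = shf_split h j 0 in h0 \<oplus>\<^sub>H (h1 \<otimes>\<^sub>H shf_norm vars (TVar (Y j))))"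

definition reduce :: "var pterm \<Rightarrow> shf" where
  "reduce \<sigma> = shf_rewrite (shf_rewrite (shf_rewrite (shf_norm vars \<sigma>) 0) 1) 2"

fun assign :: "(nat \<Rightarrow> int) \<Rightarrow> (nat \<Rightarrow> int) \<Rightarrow> var \<Rightarrow> int" where
  "assign x y (X j) = x j"
| "assign x y (Y j) = y j"

end

(* A sparse Horner form is a polynomial in infinitely many variables. Evaluation at a sequence of
   integers turns the operations on forms into those of the ring of integers, so normalization
   preserves values. Splitting at Y_j replaces Y_j^2 by the right-hand side of the curve equation,
   which preserves the value modulo wp at points of the curve; hence so does reduction, and the
   value of a term modulo wp is a function of its reduced form. *)

theory Submission
  imports Defs
begin

text \<open>Environments are infinite sequences because a form does not record how many variables it
  ranges over; dropping initial entries interprets \<open>POP\<close>.\<close>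

definition shift :: "nat \<Rightarrow> (nat \<Rightarrow> 'a) \<Rightarrow> nat \<Rightarrow> 'a" where
  "shift i N = (\<lambda>n. N (i + n))"

lemma shift_0 [simp]: "shift 0 N = N"
  by (simp add: shift_def)

lemma shift_shift [simp]: "shift i (shift j N) = shift (j + i) N"
  by (simp add: shift_def add.assoc)

lemma shift_at_0 [simp]: "shift i N 0 = N i"
  by (simp add: shift_def)

fun shf_eval :: "shf \<Rightarrow> (nat \<Rightarrow> int) \<Rightarrow> int" where
  "shf_eval (Const n) N = n"
| "shf_eval (POP i p) N = shf_eval p (shift i N)"
| "shf_eval (POW i p q) N = N 0 ^ i * shf_eval p N + shf_eval q (shift 1 N)"

lemma shf_eval_pop [simp]: "shf_eval (shf_pop i p) N = shf_eval p (shift i N)"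
  by (cases p) auto

text \<open>The merging clause is v^i * (v^j * r + 0) + q = v^(i+j) * r + q.\<close>

lemma shf_eval_pow [simp]:
  "shf_eval (shf_pow i p q) N = N 0 ^ i * shf_eval p N + shf_eval q (shift 1 N)"
  by (cases p) (auto simp: shf_pow_def power_add)

lemma shf_eval_add [simp]: "shf_eval (p \<oplus>\<^sub>H q) N = shf_eval p N + shf_eval q N"
proof (induction p q arbitrary: N rule: shf_add.induct)
  case (9 i p q j r s)
  show ?case
  proof (cases i j rule: linorder_cases)
    case less
    \<comment> \<open>Addition factors out the lower power of the head variable, so the higher one
      has to be split accordingly.\<close>
    then have "N 0 ^ j = N 0 ^ i * N 0 ^ (j - i)"
      by (simp flip: power_add)
    with less 9 show ?thesis
      by (simp add: algebra_simps)
  next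
    case greater
    then have "N 0 ^ i = N 0 ^ j * N 0 ^ (i - j)"
      by (simp flip: power_add)
    with greater 9 show ?thesis
      by (simp add: algebra_simps)
  qed (use 9 in \<open>simp add: algebra_simps\<close>)
qed (auto simp: algebra_simps)

text \<open>The last clause expands (v^i * p + q) * (v^j * r + s); \<open>shf_pop 1\<close> lifts
  \<open>q\<close> and \<open>s\<close>, which omit v, to the variable list of \<open>p\<close> and
  \<open>r\<close>.\<close>

lemma shf_eval_mult [simp]: "shf_eval (p \<otimes>\<^sub>H q) N = shf_eval p N * shf_eval q N"
  by (induction p q arbitrary: N rule: shf_mult.induct) (auto simp: algebra_simps power_add)

lemma shf_eval_neg [simp]: "shf_eval (\<ominus>\<^sub>H p) N = - shf_eval p N"
  by (induction p arbitrary: N) auto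

lemma shf_eval_power [simp]: "shf_eval (shf_power p k) N = shf_eval p N ^ k"
  by (induction k) auto

lemma nth_var_index: "v \<in> set V \<Longrightarrow> V ! var_index V v = v"
  by (induction V) (auto simp: var_index_def)

lemma shf_eval_norm:
  assumes "\<sigma> \<in> pterms V" and "\<And>v. v \<in> set V \<Longrightarrow> N (var_index V v) = a v"
  shows "shf_eval (shf_norm V \<sigma>) N = term_val a \<sigma>"
  using assms by (induction \<sigma>) (auto simp: pterms_def simp del: shf_pop.simps)

text \<open>\<open>Theta\<close> is the Horner scheme v * (v * (v + A) + 1) at v =
  \<open>N 3\<close>.\<close>

lemma shf_eval_Theta: "shf_eval Theta N = N 3 ^ 3 + coeffA * N 3 ^ 2 + N 3"
  by (simp add: Theta_def shift_def algebra_simps power2_eq_square power3_eq_cube)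

text \<open>The sequence \<open>M\<close> assigns values to the full variable list, and \<open>k\<close> is the number of
  variables consumed so far, so \<open>h\<close> is to be read relative to \<open>shift k M\<close>.\<close>

lemma shf_eval_split:
  assumes "[M j ^ 2 = shf_eval Theta (shift j M)] (mod m)"
    and "shf_split h j k = (h0, h1)"
  shows "[shf_eval h (shift k M) = shf_eval h0 (shift k M) + M j * shf_eval h1 (shift k M)] (mod m)"
  using assms(2)
proof (induction h arbitrary: k h0 h1)
  case (Const n)
  then show ?case by auto
next
  case (POP i p)
  obtain p0 p1 where "shf_split p j (k + i) = (p0, p1)"
    by fastforce
  with POP show ?case by (auto split: if_splits)
next
  case (POW i p q)
  show ?case
  proof (cases "j < k")
    case True
    with POW.prems show ?thesis by auto
  next
    case False
    obtain p0 p1 where p: "shf_split p j k = (p0, p1)"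
      by fastforce
    obtain q0 q1 where q: "shf_split q j (k + 1) = (q0, q1)"
      by fastforce
    let ?e = "\<lambda>p. shf_eval p (shift k M)"
    let ?f = "\<lambda>q. shf_eval q (shift (k + 1) M)"
    let ?s = "M k ^ i * (?e p0 + M j * ?e p1) + (?f q0 + M j * ?f q1)"
    have "[?e (POW i p q) = ?s] (mod m)"
      using POW.IH(1)[OF p] POW.IH(2)[OF q]
      by (simp only: shf_eval.simps shift_shift shift_at_0)
        (intro cong_add cong_mult cong_refl)
    also have "[?s = ?e h0 + M j * ?e h1] (mod m)"
    proof (cases "k < j")
      case True
      with POW.prems p q
      have "?s = ?e h0 + M j * ?e h1"
        by (auto simp: algebra_simps)
      then show ?thesis
        by (simp only: cong_refl)
    next
      case False
      with \<open>\<not> j < k\<close> have [simp]: "k = j"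
        by simp
      \<comment> \<open>The head variable is now the one being split off, so its even powers can be
        traded for powers of \<open>?t\<close>.\<close>
      let ?t = "shf_eval Theta (shift j M)"
      have sq: "[M j ^ (2 * n) = ?t ^ n] (mod m)" for n
        using cong_pow[OF assms(1), of n] by (simp only: power_mult)
      show ?thesis
      proof (cases "even i")
        case True
        then obtain n where n: "i = 2 * n" by (rule evenE)
        have "[?s = ?t ^ n * (?e p0 + M j * ?e p1) + (?f q0 + M j * ?f q1)] (mod m)"
          unfolding n \<open>k = j\<close> by (intro cong_add cong_mult cong_refl sq)
        also have "?t ^ n * (?e p0 + M j * ?e p1) + (?f q0 + M j * ?f q1) = ?e h0 + M j * ?e h1"
          using POW.prems p q n by (auto simp: algebra_simps)
        finally show ?thesis .
      next
        case False
        then obtain n where n: "i = 2 * n + 1" by (rule oddE)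
        with POW.prems p q
        have h: "h0 = (shf_power Theta (Suc n) \<otimes>\<^sub>H p1) \<oplus>\<^sub>H shf_pop 1 q0"
          "h1 = (shf_power Theta n \<otimes>\<^sub>H p0) \<oplus>\<^sub>H shf_pop 1 q1"
          by (auto simp del: shf_power.simps)
        \<comment> \<open>An odd power joins the factor \<open>M j\<close> of \<open>p1\<close> to
          form an even one and leaves one factor \<open>M j\<close> at \<open>p0\<close>; thus
          \<open>p0\<close> and \<open>p1\<close> change places.\<close>
        have lhs: "?s = M j ^ (2 * Suc n) * ?e p1 + M j ^ (2 * n) * (M j * ?e p0) + (?f q0 + M j * ?f q1)"
          by (simp add: n algebra_simps)
        have rhs: "?e h0 + M j * ?e h1 = ?t ^ Suc n * ?e p1 + ?t ^ n * (M j * ?e p0) + (?f q0 + M j * ?f q1)"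
          by (simp add: h algebra_simps)
        show ?thesis
          unfolding lhs rhs by (intro cong_add cong_mult cong_refl sq)
      qed
    qed
    finally show ?thesis .
  qed
qed

text \<open>The form of \<open>Y j\<close> evaluates to \<open>N j\<close> by the second hypothesis,
  so the two halves of the split are reassembled.\<close>

lemma shf_eval_rewrite:
  assumes "[N j ^ 2 = shf_eval Theta (shift j N)] (mod m)" and "var_index vars (Y j) = j"
  shows "[shf_eval (shf_rewrite h j) N = shf_eval h N] (mod m)"
proof -
  obtain h0 h1 where h: "shf_split h j 0 = (h0, h1)"
    by fastforce
  then have "shf_eval (shf_rewrite h j) N = shf_eval h0 N + N j * shf_eval h1 N"
    using assms(2) by (simp add: shf_rewrite_def)
  with shf_eval_split[OF assms(1) h] show ?thesis
    by (simp add: cong_sym_eq)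
qed

lemma shf_eval_reduce:
  assumes points: "\<And>j. j \<in> {0, 1, 2} \<Longrightarrow> Finite (x j) (y j) \<in> EC"
    and "\<sigma> \<in> pterms vars"
  shows "[shf_eval (reduce \<sigma>) (\<lambda>n. assign x y (vars ! n)) = term_val (assign x y) \<sigma>] (mod wp)"
    (is "[shf_eval _ ?N = _] (mod wp)")
proof -
  have rewr: "[shf_eval (shf_rewrite h j) ?N = shf_eval h ?N] (mod wp)" if "j \<in> {0, 1, 2}" for h j
  proof (rule shf_eval_rewrite)
    \<comment> \<open>Each \<open>X j\<close> lies three places after \<open>Y j\<close>, so a
      single \<open>Theta\<close> serves all three points.\<close>
    have "vars ! j = Y j" "vars ! (j + 3) = X j"
      using that by (auto simp: vars_def numeral_eq_Suc)
    then show "[?N j ^ 2 = shf_eval Theta (shift j ?N)] (mod wp)"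
      using points[OF that] by (simp add: EC_def shf_eval_Theta shift_def)
    show "var_index vars (Y j) = j"
      using that by (auto simp: var_index_def vars_def)
  qed
  have "[shf_eval (reduce \<sigma>) ?N = shf_eval (shf_norm vars \<sigma>) ?N] (mod wp)"
    unfolding reduce_def
    by (rule cong_trans[OF rewr cong_trans[OF rewr rewr]]) simp_all
  also have "shf_eval (shf_norm vars \<sigma>) ?N = term_val (assign x y) \<sigma>"
    using assms(2) by (rule shf_eval_norm) (simp add: nth_var_index)
  finally show ?thesis .
qed

theorem lemma5p4:
  fixes x y :: "nat \<Rightarrow> int" and \<sigma> \<tau> :: "var pterm"
  assumes points: "\<And>j. j \<in> {0, 1, 2} \<Longrightarrow> Finite (x j) (y j) \<in> EC"
    and "\<sigma> \<in> pterms vars" and "\<tau> \<in> pterms vars"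
    and "reduce \<sigma> = reduce \<tau>"
  shows "[term_val (assign x y) \<sigma> = term_val (assign x y) \<tau>] (mod wp)"
proof -
  let ?N = "\<lambda>n. assign x y (vars ! n)"
  have "[shf_eval (reduce \<sigma>) ?N = term_val (assign x y) \<sigma>] (mod wp)"
    using points assms(2) by (rule shf_eval_reduce)
  moreover have "[shf_eval (reduce \<tau>) ?N = term_val (assign x y) \<tau>] (mod wp)"
    using points assms(3) by (rule shf_eval_reduce)
  ultimately show ?thesis
    unfolding assms(4) by (rule cong_trans[OF cong_sym])
qed

end
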